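(* For every positive integer $m$, the pattern $R_{m,m}$ is similar to the section $H_{m/2^m}$ of the Sierpiński octahedron $S_\infty$ (identifying the plane $\{z=1-m/2^m\}$ with $\mathbb{R}^2$).
   Context: Chocolate game: for a positive integer $m$, $C_{m,m}$ is a two-player impartial game on an $m\times m$ chocolate bar of unit cells, one of which is poisoned (known to both players); cells are $(i,j)\in\mathbb{Z}^2$, $1\le i,j\le m$. Players alternately break the current bar along a grid line into two rectangles, eat one and pass the other (always keeping the poisoned cell); a player who receives the $1\times 1$ bar loses. A cell is a P-position if with poison there the second player has a winning strategy; $P_{m,m}$ is the set of P-positions. It is known that $(i,j)\in P_{m,m}$ iff $(i-1)\oplus(j-1)\oplus(m-i)\oplus(m-j)=0$ ($\oplus$ = bitwise XOR). The pattern is $R_{m,m}=\{(i-x,j-y)\in\mathbb{R}^2: 0\le x,y\le 1,\ (i,j)\in P_{m,m}\}$. Sierpiński octahedron: the operation $T$ on a regular octahedron with center $O$ removes, for each of its eight faces, the tetrahedron spanned by $O$ and the three midpoints of the edges of that face; what remains is six regular octahedra of half the edge length (one at each vertex). Let $S_0$ be the regular octahedron with vertices $(\pm1,0,0),(0,\pm1,0),(0,0,\pm1)$, and let $S_n$ be obtained by applying $T$ to each octahedron of $S_{n-1}$. The sets $S_n$ are nested and $S_\infty=\lim_{n\to\infty}S_n$ (their intersection). For $0\le r\le1$, $H_r=S_\infty\cap\{z=1-r\}$. *)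

theory Defs
  imports "HOL-Analysis.Analysis"
begin

type_synonym cell = "int \<times> int"
type_synonym bar = "cell set"

definition chocolate :: "nat \<Rightarrow> bar" where
  "chocolate m = {1..int m} \<times> {1..int m}"

definition breaks :: "bar \<Rightarrow> bar \<Rightarrow> bar \<Rightarrow> bool" where
  "breaks B B1 B2 \<longleftrightarrow> B1 \<noteq> {} \<and> B2 \<noteq> {} \<and>
     (\<exists>k. (B1 = {c \<in> B. fst c \<le> k} \<and> B2 = {c \<in> B. k < fst c}) \<or>
          (B1 = {c \<in> B. snd c \<le> k} \<and> B2 = {c \<in> B. k < snd c}))"

definition moves :: "cell \<Rightarrow> bar \<Rightarrow> bar set" where
  "moves p B = {B'. p \<in> B' \<and> (\<exists>E. breaks B B' E \<or> breaks B E B')}"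

text \<open>
  A complete play with poison \<open>p\<close> is the list of the successive bars, up to the bar \<open>{p}\<close>.
  The \<open>k\<close>-th bar of the list is received by the first player if \<open>k\<close> is even, by the second
  player if \<open>k\<close> is odd.  Every play can be continued to a complete one, and complete plays
  are finite since each move makes the bar smaller.
\<close>

definition complete_play :: "cell \<Rightarrow> bar \<Rightarrow> bar list \<Rightarrow> bool" where
  "complete_play p B Bs \<longleftrightarrow> Bs \<noteq> [] \<and> hd Bs = B \<and> last Bs = {p} \<and>
     (\<forall>k. Suc k < length Bs \<longrightarrow> Bs ! Suc k \<in> moves p (Bs ! k))"

definition strategy :: "cell \<Rightarrow> (bar \<Rightarrow> bar) \<Rightarrow> bool" where
  "strategy p \<sigma> \<longleftrightarrow> (\<forall>B. moves p B \<noteq> {} \<longrightarrow> \<sigma> B \<in> moves p B)"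

text \<open>The player who receives \<open>{p}\<close> loses, so the second player wins iff the last index is even.\<close>

definition second_player_wins_with :: "cell \<Rightarrow> bar \<Rightarrow> (bar \<Rightarrow> bar) \<Rightarrow> bool" where
  "second_player_wins_with p B \<sigma> \<longleftrightarrow> strategy p \<sigma> \<and>
     (\<forall>Bs. complete_play p B Bs \<and>
           (\<forall>k. odd k \<and> Suc k < length Bs \<longrightarrow> Bs ! Suc k = \<sigma> (Bs ! k))
        \<longrightarrow> even (length Bs - 1))"

definition P_positions :: "nat \<Rightarrow> cell set" where
  "P_positions m = {p \<in> chocolate m. \<exists>\<sigma>. second_player_wins_with p (chocolate m) \<sigma>}"

definition pattern :: "nat \<Rightarrow> (real \<times> real) set" where
  "pattern m = {(real_of_int i - x, real_of_int j - y) | i j x y.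
     0 \<le> x \<and> x \<le> 1 \<and> 0 \<le> y \<and> y \<le> 1 \<and> (i, j) \<in> P_positions m}"

text \<open>
  All octahedra that occur are homothetic to \<open>S\<^sub>0\<close>; \<open>octahedron c a\<close> has center \<open>c\<close>
  and vertices at distance \<open>a\<close> from \<open>c\<close> in the six axis directions.
\<close>

definition axis_dirs :: "(real \<times> real \<times> real) set" where
  "axis_dirs = {(1,0,0), (-1,0,0), (0,1,0), (0,-1,0), (0,0,1), (0,0,-1)}"

definition octahedron :: "real \<times> real \<times> real \<Rightarrow> real \<Rightarrow> (real \<times> real \<times> real) set" where
  "octahedron c a = convex hull ((\<lambda>d. c + a *\<^sub>R d) ` axis_dirs)"

text \<open>The face with signs \<open>s\<^sub>1, s\<^sub>2, s\<^sub>3\<close> has the three vertices \<open>u\<close>, \<open>v\<close>, \<open>w\<close> below.\<close>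

definition face_tetrahedron ::
  "real \<times> real \<times> real \<Rightarrow> real \<Rightarrow> real \<Rightarrow> real \<Rightarrow> real \<Rightarrow> (real \<times> real \<times> real) set" where
  "face_tetrahedron c a s1 s2 s3 =
     (let u = c + a *\<^sub>R (s1,0,0); v = c + a *\<^sub>R (0,s2,0); w = c + a *\<^sub>R (0,0,s3)
      in convex hull {c, midpoint u v, midpoint u w, midpoint v w})"

text \<open>
  The closure restores the boundaries that the remaining closed octahedra share with the
  removed tetrahedra; see \<open>octahedron_T_eq\<close> below.
\<close>

definition octahedron_T :: "real \<times> real \<times> real \<Rightarrow> real \<Rightarrow> (real \<times> real \<times> real) set" where
  "octahedron_T c a = closure (octahedron c a -
     (\<Union>s1\<in>{1,-1}. \<Union>s2\<in>{1,-1}. \<Union>s3\<in>{1,-1}. face_tetrahedron c a s1 s2 s3))"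

text \<open>Centers and radii of the \<open>6\<^sup>n\<close> octahedra of \<open>S\<^sub>n\<close>.\<close>

fun level_octahedra :: "nat \<Rightarrow> ((real \<times> real \<times> real) \<times> real) set" where
  "level_octahedra 0 = {(0, 1)}"
| "level_octahedra (Suc n) =
     (\<Union>(c, a)\<in>level_octahedra n. (\<lambda>d. (c + (a/2) *\<^sub>R d, a/2)) ` axis_dirs)"

fun sierpinski_level :: "nat \<Rightarrow> (real \<times> real \<times> real) set" where
  "sierpinski_level 0 = octahedron 0 1"
| "sierpinski_level (Suc n) = (\<Union>(c, a)\<in>level_octahedra n. octahedron_T c a)"

definition sierpinski_octahedron :: "(real \<times> real \<times> real) set" where
  "sierpinski_octahedron = (\<Inter>n. sierpinski_level n)"

definition section_H :: "real \<Rightarrow> (real \<times> real) set" where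
  "section_H r = {(x, y). (x, y, 1 - r) \<in> sierpinski_octahedron}"

definition similar :: "'a::metric_space set \<Rightarrow> 'a set \<Rightarrow> bool" where
  "similar A B \<longleftrightarrow> (\<exists>f k. k > 0 \<and> surj f \<and> (\<forall>u v. dist (f u) (f v) = k * dist u v) \<and> f ` A = B)"

lemma octahedron_iff:
  assumes "a > 0"
  shows "(x, y, z) \<in> octahedron (c1, c2, c3) a \<longleftrightarrow> \<bar>x - c1\<bar> + \<bar>y - c2\<bar> + \<bar>z - c3\<bar> \<le> a"
proof
  let ?K = "{p :: real \<times> real \<times> real. \<bar>fst p - c1\<bar> + \<bar>fst (snd p) - c2\<bar> + \<bar>snd (snd p) - c3\<bar> \<le> a}"
  have "convex ?K"
  proof (rule convexI)
    fix p q :: "real \<times> real \<times> real" and u v :: real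
    assume pq: "p \<in> ?K" "q \<in> ?K" and uv: "0 \<le> u" "0 \<le> v" "u + v = 1"
    have *: "\<bar>u * s + v * t - c\<bar> \<le> u * \<bar>s - c\<bar> + v * \<bar>t - c\<bar>" for s t c :: real
    proof -
      have "u * s + v * t - c = u * s + v * t - (u + v) * c" using uv by simp
      also have "\<dots> = u * (s - c) + v * (t - c)" by (simp add: algebra_simps)
      also have "\<bar>\<dots>\<bar> \<le> \<bar>u * (s - c)\<bar> + \<bar>v * (t - c)\<bar>" by (rule abs_triangle_ineq)
      finally show ?thesis using uv by (simp add: abs_mult)
    qed
    let ?N = "\<lambda>p :: real \<times> real \<times> real. \<bar>fst p - c1\<bar> + \<bar>fst (snd p) - c2\<bar> + \<bar>snd (snd p) - c3\<bar>"
    have "?N (u *\<^sub>R p + v *\<^sub>R q) \<le> u * ?N p + v * ?N q"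
      using *[of "fst p" "fst q" c1] *[of "fst (snd p)" "fst (snd q)" c2]
        *[of "snd (snd p)" "snd (snd q)" c3] by (simp add: distrib_left)
    also have "\<dots> \<le> u * a + v * a"
      using pq uv by (intro add_mono mult_left_mono) auto
    also have "\<dots> = a" using uv by (simp flip: distrib_right)
    finally show "u *\<^sub>R p + v *\<^sub>R q \<in> ?K" by simp
  qed
  then have "octahedron (c1, c2, c3) a \<subseteq> ?K"
    unfolding octahedron_def using assms by (intro hull_minimal) (auto simp: axis_dirs_def)
  then show "(x, y, z) \<in> octahedron (c1, c2, c3) a \<Longrightarrow> \<bar>x - c1\<bar> + \<bar>y - c2\<bar> + \<bar>z - c3\<bar> \<le> a"
    by auto
next
  assume le: "\<bar>x - c1\<bar> + \<bar>y - c2\<bar> + \<bar>z - c3\<bar> \<le> a"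
  let ?C = "octahedron (c1, c2, c3) a"
  have vert: "(c1, c2, c3) + a *\<^sub>R d \<in> ?C" if "d \<in> axis_dirs" for d
    unfolding octahedron_def using that by (intro hull_inc) auto
  have conv: "convex ?C" unfolding octahedron_def by (rule convex_convex_hull)
  have v: "(c1 + a, c2, c3) \<in> ?C" "(c1 - a, c2, c3) \<in> ?C" "(c1, c2 + a, c3) \<in> ?C"
    "(c1, c2 - a, c3) \<in> ?C" "(c1, c2, c3 + a) \<in> ?C" "(c1, c2, c3 - a) \<in> ?C"
    using vert[of "(1,0,0)"] vert[of "(-1,0,0)"] vert[of "(0,1,0)"]
      vert[of "(0,-1,0)"] vert[of "(0,0,1)"] vert[of "(0,0,-1)"] by (auto simp: axis_dirs_def)
  have "(1/2) *\<^sub>R (c1 + a, c2, c3) + (1/2) *\<^sub>R (c1 - a, c2, c3) \<in> ?C"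
    using conv v by (intro convexD) auto
  then have c: "(c1, c2, c3) \<in> ?C" by (simp add: field_simps)
  let ?s = "\<lambda>t::real. if t \<ge> 0 then a else - a"
  define w where "w = (\<lambda>i::nat. [1 - (\<bar>x - c1\<bar> + \<bar>y - c2\<bar> + \<bar>z - c3\<bar>) / a, \<bar>x - c1\<bar> / a, \<bar>y - c2\<bar> / a, \<bar>z - c3\<bar> / a] ! i)"
  define p where "p = (\<lambda>i::nat. [(c1, c2, c3), (c1 + ?s (x - c1), c2, c3),
      (c1, c2 + ?s (y - c2), c3), (c1, c2, c3 + ?s (z - c3))] ! i)"
  have I: "i \<in> {..<4} \<longleftrightarrow> i = 0 \<or> i = 1 \<or> i = 2 \<or> i = (3::nat)" for i by auto
  have "(\<Sum>i<4. w i *\<^sub>R p i) \<in> ?C"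
  proof (rule convex_sum)
    show "sum w {..<4} = 1" using assms
      by (simp add: w_def eval_nat_numeral field_simps)
    show "0 \<le> w i" if "i \<in> {..<4}" for i
      using that assms le unfolding I by (auto simp: w_def field_simps)
    show "p i \<in> ?C" if "i \<in> {..<4}" for i
      using that c v unfolding I by (auto simp: p_def)
  qed (use conv in auto)
  also have "(\<Sum>i<4. w i *\<^sub>R p i) = (x, y, z)"
    using assms by (simp add: w_def p_def eval_nat_numeral) (auto simp: field_simps)
  finally show "(x, y, z) \<in> ?C" .
qed

lemma face_tetrahedron_iff:
  assumes "a > 0" "s1 \<in> {1,-1}" "s2 \<in> {1,-1}" "s3 \<in> {1,-1}"
  shows "(c1 + x, c2 + y, c3 + z) \<in> face_tetrahedron (c1, c2, c3) a s1 s2 s3 \<longleftrightarrow>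
    s1 * x \<le> s2 * y + s3 * z \<and> s2 * y \<le> s1 * x + s3 * z \<and> s3 * z \<le> s1 * x + s2 * y \<and>
    s1 * x + s2 * y + s3 * z \<le> a"
    (is "?L \<longleftrightarrow> ?R")
proof -
  let ?P = "{(c1, c2, c3), (c1 + s1 * a / 2, c2 + s2 * a / 2, c3),
    (c1 + s1 * a / 2, c2, c3 + s3 * a / 2), (c1, c2 + s2 * a / 2, c3 + s3 * a / 2)}"
  have T: "face_tetrahedron (c1, c2, c3) a s1 s2 s3 = convex hull ?P"
    unfolding face_tetrahedron_def Let_def midpoint_def
    by (rule arg_cong[where f = "\<lambda>S. convex hull S"]) (simp add: field_simps)
  have sq: "s1 * s1 = 1" "s2 * s2 = 1" "s3 * s3 = 1" using assms by auto
  let ?v = "\<lambda>t1 t2 t3 :: real. (t1 * s1, t2 * s2, t3 * s3)"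
  let ?H = "\<lambda>t1 t2 t3 b :: real. {p. (t1 * s1, t2 * s2, t3 * s3) \<bullet> p \<le> b + (t1 * s1, t2 * s2, t3 * s3) \<bullet> (c1, c2, c3)}"
  let ?K = "?H 1 (-1) (-1) 0 \<inter> ?H (-1) 1 (-1) 0 \<inter> ?H (-1) (-1) 1 0 \<inter> ?H 1 1 1 a"
  have "convex hull ?P \<subseteq> ?K"
  proof (rule hull_minimal)
    show "?P \<subseteq> ?K" using assms by (auto simp: field_simps)
    show "convex ?K" by (intro convex_Int convex_halfspace_le)
  qed
  then have "?L \<Longrightarrow> (c1 + x, c2 + y, c3 + z) \<in> ?K" unfolding T by blast
  then have 1: "?L \<Longrightarrow> ?R" by (simp add: algebra_simps)
  have 2: ?L if R: ?R
  proof -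
    define w where "w = (\<lambda>i::nat. [1 - (s1 * x + s2 * y + s3 * z) / a, (s1 * x + s2 * y - s3 * z) / a,
      (s1 * x - s2 * y + s3 * z) / a, (s2 * y + s3 * z - s1 * x) / a] ! i)"
    define p where "p = (\<lambda>i::nat. [(c1, c2, c3), (c1 + s1 * a / 2, c2 + s2 * a / 2, c3),
    (c1 + s1 * a / 2, c2, c3 + s3 * a / 2), (c1, c2 + s2 * a / 2, c3 + s3 * a / 2)] ! i)"
    have I: "i \<in> {..<4} \<longleftrightarrow> i = 0 \<or> i = 1 \<or> i = 2 \<or> i = (3::nat)" for i by auto
    have "(\<Sum>i<4. w i *\<^sub>R p i) \<in> convex hull ?P"
    proof (rule convex_sum)
      show "sum w {..<4} = 1" using assms(1)
        by (simp add: w_def eval_nat_numeral field_simps)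
      show "0 \<le> w i" if "i \<in> {..<4}" for i
        using that assms(1) R unfolding I by (auto simp: w_def)
      show "p i \<in> convex hull ?P" if "i \<in> {..<4}" for i
        using that unfolding I by (auto simp: p_def intro: hull_inc)
    qed auto
    also have "(\<Sum>i<4. w i *\<^sub>R p i) = (c1 + x, c2 + y, c3 + z)"
      using assms by (simp add: w_def p_def eval_nat_numeral) (auto simp: field_simps)
    finally show ?L unfolding T .
  qed
  show ?thesis using 1 2 by blast
qed

lemma octahedron_minus_tetrahedra:
  assumes "a > 0"
  shows "(c1 + x, c2 + y, c3 + z) \<in> octahedron (c1, c2, c3) a -
     (\<Union>s1\<in>{1,-1}. \<Union>s2\<in>{1,-1}. \<Union>s3\<in>{1,-1}. face_tetrahedron (c1, c2, c3) a s1 s2 s3) \<longleftrightarrow>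
    \<bar>x\<bar> + \<bar>y\<bar> + \<bar>z\<bar> \<le> a \<and> (\<bar>x\<bar> > \<bar>y\<bar> + \<bar>z\<bar> \<or> \<bar>y\<bar> > \<bar>x\<bar> + \<bar>z\<bar> \<or> \<bar>z\<bar> > \<bar>x\<bar> + \<bar>y\<bar>)"
  using assms
  by (simp add: octahedron_iff face_tetrahedron_iff) argo

lemma octahedron_T_eq:
  assumes "a > 0"
  shows "octahedron_T c a = (\<Union>d\<in>axis_dirs. octahedron (c + (a/2) *\<^sub>R d) (a/2))"
proof -
  obtain c1 c2 c3 where c: "c = (c1, c2, c3)" by (cases c) auto
  define V where "V = octahedron c a -
     (\<Union>s1\<in>{1,-1}. \<Union>s2\<in>{1,-1}. \<Union>s3\<in>{1,-1}. face_tetrahedron c a s1 s2 s3)"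
  define U where "U = (\<Union>d\<in>axis_dirs. octahedron (c + (a/2) *\<^sub>R d) (a/2))"
  have V: "(c1 + x, c2 + y, c3 + z) \<in> V \<longleftrightarrow> \<bar>x\<bar> + \<bar>y\<bar> + \<bar>z\<bar> \<le> a \<and>
     (\<bar>x\<bar> > \<bar>y\<bar> + \<bar>z\<bar> \<or> \<bar>y\<bar> > \<bar>x\<bar> + \<bar>z\<bar> \<or> \<bar>z\<bar> > \<bar>x\<bar> + \<bar>y\<bar>)" for x y z
    unfolding V_def c using octahedron_minus_tetrahedra[OF assms] .
  have U: "(c1 + x, c2 + y, c3 + z) \<in> U \<longleftrightarrow> \<bar>x\<bar> + \<bar>y\<bar> + \<bar>z\<bar> \<le> a \<and>
     (\<bar>x\<bar> \<ge> \<bar>y\<bar> + \<bar>z\<bar> \<or> \<bar>y\<bar> \<ge> \<bar>x\<bar> + \<bar>z\<bar> \<or> \<bar>z\<bar> \<ge> \<bar>x\<bar> + \<bar>y\<bar>)" for x y z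
    unfolding U_def c axis_dirs_def using assms by (simp add: octahedron_iff) argo
  have ex: "\<exists>x y z. p = (c1 + x, c2 + y, c3 + z)" for p :: "real \<times> real \<times> real"
  proof -
    obtain p1 p2 p3 where "p = (p1, p2, p3)" by (cases p) auto
    then have "p = (c1 + (p1 - c1), c2 + (p2 - c2), c3 + (p3 - c3))" by simp
    then show ?thesis by blast
  qed
  have "V \<subseteq> U"
  proof
    fix p assume "p \<in> V"
    with ex[of p] V U show "p \<in> U" by force
  qed
  moreover have "closed U"
    unfolding U_def octahedron_def axis_dirs_def
    by (intro closed_UN finite.intros ballI compact_imp_closed finite_imp_compact_convex_hull finite_imageI)
  ultimately have 1: "closure V \<subseteq> U" by (rule closure_minimal)
  have 2: "U \<subseteq> closure V"
  proof
    fix p assume p: "p \<in> U"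
    obtain x y z where xyz: "p = (c1 + x, c2 + y, c3 + z)" using ex by blast
    note u = p[unfolded xyz U]
    obtain e1 e2 e3 where e: "\<And>t. 0 < t \<Longrightarrow> t < 1 \<Longrightarrow>
        (c1 + ((1 - t) * x + t * e1), c2 + ((1 - t) * y + t * e2), c3 + ((1 - t) * z + t * e3)) \<in> V"
    proof -
      have abs: "\<bar>(1 - t) * x + t * (if x \<ge> 0 then a else - a)\<bar> = (1 - t) * \<bar>x\<bar> + t * a"
        if "0 < t" "t < 1" for t x :: real
      proof (cases "x \<ge> 0")
        case True
        then show ?thesis using that assms by simp
      next
        case False
        then have "(1 - t) * x \<le> 0" "t * a > 0" using that assms by (auto simp: mult_le_0_iff)
        then have "\<bar>(1 - t) * x - t * a\<bar> = - ((1 - t) * x) + t * a" by linarith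
        then show ?thesis using False by simp
      qed
      have abs0: "\<bar>(1 - t) * x + t * 0\<bar> = (1 - t) * \<bar>x\<bar>" if "t < 1" for t x :: real
        using that by (simp add: abs_mult)
      have sum: "(1 - t) * l + (1 - t) * m + (1 - t) * n + t * a \<le> a"
        if "l + m + n \<le> a" "0 < t" "t < 1" for l m n t :: real
      proof -
        have "(1 - t) * (l + m + n) \<le> (1 - t) * a" using that by (intro mult_left_mono) auto
        then show ?thesis by (simp add: algebra_simps)
      qed
      have less: "(1 - t) * m + (1 - t) * n < (1 - t) * l + t * a"
        if "m + n \<le> l" "0 < t" "t < 1" for l m n t :: real
      proof -
        have "(1 - t) * (m + n) \<le> (1 - t) * l" using that by (intro mult_left_mono) auto
        moreover have "t * a > 0" using that assms by simp
        ultimately show ?thesis by (simp add: algebra_simps)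
      qed
      from u consider "\<bar>y\<bar> + \<bar>z\<bar> \<le> \<bar>x\<bar>" | "\<bar>x\<bar> + \<bar>z\<bar> \<le> \<bar>y\<bar>" | "\<bar>x\<bar> + \<bar>y\<bar> \<le> \<bar>z\<bar>" by blast
      then show thesis
      proof cases
        case 1
        show thesis
        proof (rule that[of "if x \<ge> 0 then a else - a" 0 0])
          fix t :: real assume t: "0 < t" "t < 1"
          show "(c1 + ((1 - t) * x + t * (if x \<ge> 0 then a else - a)),
              c2 + ((1 - t) * y + t * 0), c3 + ((1 - t) * z + t * 0)) \<in> V"
            unfolding V abs[OF t] abs0[OF t(2)]
            using sum[of "\<bar>x\<bar>" "\<bar>y\<bar>" "\<bar>z\<bar>" t] less[OF 1 t] u t by linarith
        qed
      next
        case 2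
        show thesis
        proof (rule that[of 0 "if y \<ge> 0 then a else - a" 0])
          fix t :: real assume t: "0 < t" "t < 1"
          show "(c1 + ((1 - t) * x + t * 0),
              c2 + ((1 - t) * y + t * (if y \<ge> 0 then a else - a)), c3 + ((1 - t) * z + t * 0)) \<in> V"
            unfolding V abs[OF t] abs0[OF t(2)]
            using sum[of "\<bar>x\<bar>" "\<bar>y\<bar>" "\<bar>z\<bar>" t] less[OF 2 t] u t by linarith
        qed
      next
        case 3
        show thesis
        proof (rule that[of 0 0 "if z \<ge> 0 then a else - a"])
          fix t :: real assume t: "0 < t" "t < 1"
          show "(c1 + ((1 - t) * x + t * 0),
              c2 + ((1 - t) * y + t * 0), c3 + ((1 - t) * z + t * (if z \<ge> 0 then a else - a))) \<in> V"
            unfolding V abs[OF t] abs0[OF t(2)]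
            using sum[of "\<bar>x\<bar>" "\<bar>y\<bar>" "\<bar>z\<bar>" t] less[OF 3 t] u t by linarith
        qed
      qed
    qed
    let ?t = "\<lambda>n. inverse (real (Suc (Suc n)))"
    have t0: "?t \<longlonglongrightarrow> 0"
      using LIMSEQ_Suc[OF LIMSEQ_inverse_real_of_nat] by simp
    have l: "(\<lambda>n. b + ((1 - ?t n) * v + ?t n * w)) \<longlonglongrightarrow> b + v" for b v w :: real
    proof -
      have "(\<lambda>n. b + ((1 - ?t n) * v + ?t n * w)) \<longlonglongrightarrow> b + ((1 - 0) * v + 0 * w)"
        by (intro tendsto_intros t0)
      then show ?thesis by simp
    qed
    let ?q = "\<lambda>n. (c1 + ((1 - ?t n) * x + ?t n * e1), c2 + ((1 - ?t n) * y + ?t n * e2),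
        c3 + ((1 - ?t n) * z + ?t n * e3))"
    have "?q \<longlonglongrightarrow> p" unfolding xyz by (intro tendsto_Pair l)
    moreover have "?q n \<in> V" for n
      by (rule e) (simp_all add: inverse_less_1_iff)
    ultimately show "p \<in> closure V"
      unfolding closure_sequential by (intro exI[of _ ?q]) simp
  qed
  from 1 2 show ?thesis unfolding octahedron_T_def U_def V_def by blast
qed

end

theory Submission
  imports Defs
begin

text \<open>
  The game is Nim with four heaps, so for \<open>a + b = c + d = m - 1\<close> the cell \<open>(a + 1, c + 1)\<close> is a
  P-position iff \<open>a \<oplus> b = c \<oplus> d\<close>. Splitting off the lowest bits of \<open>a, b, c, d\<close> gives the P-cells of
  side \<open>2k\<close> by replacing every P-cell of side \<open>k\<close> with four, and those of side \<open>2k + 1\<close> as the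
  concentric, doubled and thinned out, union of the P-cells of sides \<open>k\<close> and \<open>k + 1\<close>; no other
  parities occur because \<open>a \<oplus> b\<close> and \<open>a + b\<close> have the same parity.

  After scaling by \<open>2\<^sup>n\<close>, the centres of the octahedra of level \<open>n + 1\<close> are \<open>2c + d\<close> for the old centres
  \<open>c\<close> and the six unit vectors \<open>d\<close>. At height \<open>2\<^sup>n - m\<close> they therefore satisfy the same recursion, in
  coordinates rotated by 45 degrees. A plane at integer height meets octahedra of level \<open>n\<close> in
  equators and in single vertices. The equators lie in every later level, since a square is tiled by
  four half-size squares, and the vertices lie in these equators. So the section is
  the union of the equators, which are the squares of the pattern.
\<close>

unbundle bit_operations_syntax

section \<open>The chocolate game as Nim\<close>

lemma xor_cancel_left: "a XOR (a XOR b) = (b::nat)"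
  by (simp flip: xor.assoc)

lemma xor_eq_left_iff: "a XOR b = a XOR c \<longleftrightarrow> b = (c::nat)"
  by (metis xor_cancel_left)

lemma xor_eq_right_iff: "b XOR a = c XOR a \<longleftrightarrow> b = (c::nat)"
  by (metis xor_eq_left_iff xor.commute)

text \<open>\<open>k\<close> is the highest set bit of \<open>s\<close>: XOR with \<open>s\<close>
  clears it in \<open>x\<close> and keeps all higher bits of \<open>x\<close>. The induction drops
  the lowest bit until \<open>s = 1\<close>.\<close>

lemma xor_decreasing_bit:
  fixes s :: nat
  assumes "s \<noteq> 0"
  shows "\<exists>k. bit s k \<and> (\<forall>x. bit x k \<longrightarrow> x XOR s < x)"
  using assms
proof (induction s rule: less_induct)
  case (less s)
  show ?case
  proof (cases "s div 2 = 0")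
    case True
    then have "s = 1" using less.prems by presburger
    moreover have "x XOR 1 < x" if "bit x 0" for x :: nat
      using that xor_one_eq[of x] by (simp add: bit_0 del: One_nat_def) (simp add: odd_pos)
    ultimately show ?thesis by (intro exI[of _ 0]) (simp add: bit_0)
  next
    case False
    with less.IH[of "s div 2"] obtain k where k: "bit (s div 2) k"
      and *: "\<And>x. bit x k \<Longrightarrow> x XOR (s div 2) < x" by auto
    have "x XOR s < x" if "bit x (Suc k)" for x
    proof -
      have "(x div 2) XOR (s div 2) < x div 2"
        using that by (intro *) (simp add: bit_Suc)
      then show ?thesis by (simp add: xor_nat_rec[of x s] of_bool_def) presburger
    qed
    with k show ?thesis by (intro exI[of _ "Suc k"]) (simp add: bit_Suc)
  qed
qed

text \<open>Bouton's argument: the top bit of the nim-sum \<open>s\<close> is set in some heap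
  \<open>x\<close>, and replacing \<open>x\<close> by the smaller \<open>x XOR s\<close> makes the
  nim-sum vanish.\<close>

lemma nim_winning_move:
  fixes a b c d :: nat
  assumes "a XOR b \<noteq> c XOR d"
  shows "(\<exists>a'<a. a' XOR b = c XOR d) \<or> (\<exists>b'<b. a XOR b' = c XOR d) \<or>
    (\<exists>c'<c. a XOR b = c' XOR d) \<or> (\<exists>d'<d. a XOR b = c XOR d')"
proof -
  define s where "s = a XOR b XOR c XOR d"
  have "s \<noteq> 0"
  proof
    assume "s = 0"
    then have "(a XOR b) XOR (a XOR b XOR c XOR d) = a XOR b" by (simp add: s_def)
    moreover have "(a XOR b) XOR (a XOR b XOR c XOR d) = c XOR d"
      by (simp add: ac_simps xor_cancel_left)
    ultimately show False using assms by simp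
  qed
  then obtain k where k: "bit s k" and *: "\<And>x. bit x k \<Longrightarrow> x XOR s < x"
    using xor_decreasing_bit by blast
  have "bit a k \<or> bit b k \<or> bit c k \<or> bit d k"
    using k by (auto simp: s_def bit_xor_iff)
  moreover have "(a XOR s) XOR b = c XOR d" "a XOR (b XOR s) = c XOR d"
    "a XOR b = (c XOR s) XOR d" "a XOR b = c XOR (d XOR s)"
    by (simp_all add: s_def ac_simps xor_cancel_left)
  ultimately show ?thesis using * by metis
qed

text \<open>\<open>rect p a b c d\<close> extends \<open>a\<close>, \<open>b\<close>, \<open>c\<close>, \<open>d\<close> cells from \<open>p\<close> in the four directions, so a move
  shortens exactly one of the four arms: the game is Nim with these four heaps.\<close>

definition rect :: "cell \<Rightarrow> nat \<Rightarrow> nat \<Rightarrow> nat \<Rightarrow> nat \<Rightarrow> bar" where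
  "rect p a b c d = {fst p - int a..fst p + int b} \<times> {snd p - int c..snd p + int d}"

lemma rect_inject:
  "rect p a b c d = rect p a' b' c' d' \<longleftrightarrow> a = a' \<and> b = b' \<and> c = c' \<and> d = d'"
  by (auto simp: rect_def times_eq_iff)

lemma rect_0: "rect p 0 0 0 0 = {p}"
  by (auto simp: rect_def)

lemma finite_rect: "finite (rect p a b c d)"
  by (simp add: rect_def)

text \<open>The kept piece contains \<open>p\<close> and the eaten piece is nonempty, so the cut
  strictly shortens the arm it crosses and leaves the other three.\<close>

lemma moves_rect_cases:
  assumes "B \<in> moves p (rect p a b c d)"
  obtains a' where "a' < a" "B = rect p a' b c d"
  | b' where "b' < b" "B = rect p a b' c d"
  | c' where "c' < c" "B = rect p a b c' d"
  | d' where "d' < d" "B = rect p a b c d'"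
proof -
  obtain i j where p: "p = (i, j)" by (cases p)
  let ?R = "rect p a b c d"
  obtain E where "p \<in> B" and E: "breaks ?R B E \<or> breaks ?R E B"
    using assms by (auto simp: moves_def)
  from E consider
      k where "B = {q \<in> ?R. fst q \<le> k}" "E = {q \<in> ?R. k < fst q}" "E \<noteq> {}"
    | k where "B = {q \<in> ?R. k < fst q}" "E = {q \<in> ?R. fst q \<le> k}" "E \<noteq> {}"
    | k where "B = {q \<in> ?R. snd q \<le> k}" "E = {q \<in> ?R. k < snd q}" "E \<noteq> {}"
    | k where "B = {q \<in> ?R. k < snd q}" "E = {q \<in> ?R. snd q \<le> k}" "E \<noteq> {}"
    unfolding breaks_def by (elim disjE conjE exE) blast+
  then show thesis
  proof cases
    case (1 k)
    with \<open>p \<in> B\<close> have "i \<le> k" "k < i + int b" by (auto simp: p rect_def)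
    then show thesis
      by (intro that(2)[of "nat (k - i)"]) (auto simp: 1 p rect_def)
  next
    case (2 k)
    with \<open>p \<in> B\<close> have "k < i" "i - int a \<le> k" by (auto simp: p rect_def)
    then show thesis
      by (intro that(1)[of "nat (i - k - 1)"]) (auto simp: 2 p rect_def)
  next
    case (3 k)
    with \<open>p \<in> B\<close> have "j \<le> k" "k < j + int d" by (auto simp: p rect_def)
    then show thesis
      by (intro that(4)[of "nat (k - j)"]) (auto simp: 3 p rect_def)
  next
    case (4 k)
    with \<open>p \<in> B\<close> have "k < j" "j - int c \<le> k" by (auto simp: p rect_def)
    then show thesis
      by (intro that(3)[of "nat (j - k - 1)"]) (auto simp: 4 p rect_def)
  qed
qed

lemma rect_moves:
  "a' < a \<Longrightarrow> rect p a' b c d \<in> moves p (rect p a b c d)"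
  "b' < b \<Longrightarrow> rect p a b' c d \<in> moves p (rect p a b c d)"
  "c' < c \<Longrightarrow> rect p a b c' d \<in> moves p (rect p a b c d)"
  "d' < d \<Longrightarrow> rect p a b c d' \<in> moves p (rect p a b c d)"
proof -
  obtain i j where p: "p = (i, j)" by (cases p)
  let ?R = "rect p a b c d"
  have breaksI: "breaks ?R B E"
    if "B = {q \<in> ?R. f q \<le> k}" "E = {q \<in> ?R. k < f q}" "B \<noteq> {}" "E \<noteq> {}" "f = fst \<or> f = snd"
    for B E f k
    unfolding breaks_def using that by (intro conjI exI[of _ k]) auto
  have move: "B \<in> moves p ?R" if "p \<in> B" "q \<in> E"
    "B = {q \<in> ?R. f q \<le> k} \<and> E = {q \<in> ?R. k < f q} \<or> E = {q \<in> ?R. f q \<le> k} \<and> B = {q \<in> ?R. k < f q}"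
    "f = fst \<or> f = snd" for B E q f k
  proof -
    have ne: "B \<noteq> {}" "E \<noteq> {}" using that(1,2) by blast+
    from that(3) have "breaks ?R B E \<or> breaks ?R E B"
    proof
      assume "B = {q \<in> ?R. f q \<le> k} \<and> E = {q \<in> ?R. k < f q}"
      then show ?thesis using breaksI[OF _ _ ne that(4)] by (intro disjI1) (elim conjE)
    next
      assume "E = {q \<in> ?R. f q \<le> k} \<and> B = {q \<in> ?R. k < f q}"
      then show ?thesis using breaksI[OF _ _ ne(2,1) that(4)] by (intro disjI2) (elim conjE)
    qed
    with that(1) show ?thesis by (auto simp: moves_def)
  qed
  \<comment> \<open>The end cell of the shortened arm witnesses that the eaten piece is
    nonempty.\<close>
  show "rect p a' b c d \<in> moves p ?R" if "a' < a"
    by (rule move[of _ "(i - int a, j)" "{q \<in> ?R. fst q \<le> i - int a' - 1}" fst "i - int a' - 1"])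
      (use that in \<open>auto simp: p rect_def\<close>)
  show "rect p a b' c d \<in> moves p ?R" if "b' < b"
    by (rule move[of _ "(i + int b, j)" "{q \<in> ?R. i + int b' < fst q}" fst "i + int b'"])
      (use that in \<open>auto simp: p rect_def\<close>)
  show "rect p a b c' d \<in> moves p ?R" if "c' < c"
    by (rule move[of _ "(i, j - int c)" "{q \<in> ?R. snd q \<le> j - int c' - 1}" snd "j - int c' - 1"])
      (use that in \<open>auto simp: p rect_def\<close>)
  show "rect p a b c d' \<in> moves p ?R" if "d' < d"
    by (rule move[of _ "(i, j + int d)" "{q \<in> ?R. j + int d' < snd q}" snd "j + int d'"])
      (use that in \<open>auto simp: p rect_def\<close>)
qed

definition balanced :: "cell \<Rightarrow> bar \<Rightarrow> bool" where
  "balanced p B \<longleftrightarrow> (\<exists>a b c d. B = rect p a b c d \<and> a XOR b = c XOR d)"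

text \<open>Not the negation of \<open>balanced\<close>: a set of cells that is no rectangle around
  \<open>p\<close> is neither.\<close>

definition unbalanced :: "cell \<Rightarrow> bar \<Rightarrow> bool" where
  "unbalanced p B \<longleftrightarrow> (\<exists>a b c d. B = rect p a b c d \<and> a XOR b \<noteq> c XOR d)"

lemma not_balanced_if_unbalanced: "unbalanced p B \<Longrightarrow> \<not> balanced p B"
  by (auto simp: balanced_def unbalanced_def rect_inject)

lemma balanced_singleton: "balanced p {p}"
  unfolding balanced_def rect_0[symmetric] by (intro exI conjI) (rule refl, simp)

text \<open>Only one heap changes, and XOR is injective in each argument, so exactly one side of the
  equation changes.\<close>

lemma unbalanced_after_move:
  assumes "balanced p B" "B' \<in> moves p B"
  shows "unbalanced p B'"
proof -
  obtain a b c d where B: "B = rect p a b c d" and x: "a XOR b = c XOR d"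
    using assms(1) by (auto simp: balanced_def)
  from assms(2)[unfolded B] show ?thesis
    unfolding unbalanced_def
    by (cases rule: moves_rect_cases)
      (metis x xor_eq_left_iff xor_eq_right_iff less_irrefl)+
qed

lemma balancing_move:
  assumes "unbalanced p B"
  shows "\<exists>B'\<in>moves p B. balanced p B'"
proof -
  obtain a b c d where B: "B = rect p a b c d" and x: "a XOR b \<noteq> c XOR d"
    using assms by (auto simp: unbalanced_def)
  have "balanced p (rect p a' b' c' d')" if "a' XOR b' = c' XOR d'" for a' b' c' d'
    using that by (auto simp: balanced_def)
  with nim_winning_move[OF x] show ?thesis
    unfolding B by (elim disjE exE conjE) (meson rect_moves)+
qed

lemma moves_nonempty_if_balanced:
  assumes "balanced p B" "B \<noteq> {p}"
  shows "moves p B \<noteq> {}"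
proof -
  obtain a b c d where B: "B = rect p a b c d"
    using assms(1) by (auto simp: balanced_def)
  have "0 < a \<or> 0 < b \<or> 0 < c \<or> 0 < d"
    using assms(2) rect_0[of p] unfolding B by (metis neq0_conv)
  then show ?thesis unfolding B by (elim disjE) (metis rect_moves empty_iff)+
qed

section \<open>Plays and strategies\<close>

lemma moves_psubset: "B' \<in> moves p B \<Longrightarrow> B' \<subset> B"
  unfolding moves_def breaks_def by force

text \<open>The flag \<open>e\<close> records whether the user of \<open>\<sigma>\<close> moves at
  even indices. Prefixing a bar flips it, which makes induction over plays possible.\<close>

definition follows :: "bool \<Rightarrow> (bar \<Rightarrow> bar) \<Rightarrow> bar list \<Rightarrow> bool" where
  "follows e \<sigma> Bs \<longleftrightarrow> (\<forall>k. even k = e \<and> Suc k < length Bs \<longrightarrow> Bs ! Suc k = \<sigma> (Bs ! k))"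

lemma play_Cons:
  assumes "complete_play p B' Bs" "follows (\<not> e) \<sigma> Bs" "B' \<in> moves p B" "e \<Longrightarrow> B' = \<sigma> B"
  shows "complete_play p B (B # Bs)" "follows e \<sigma> (B # Bs)"
proof -
  have "Bs \<noteq> []" "Bs ! 0 = B'"
    using assms(1) by (auto simp: complete_play_def hd_conv_nth)
  then show "complete_play p B (B # Bs)" "follows e \<sigma> (B # Bs)"
    using assms by (auto simp: complete_play_def follows_def nth_Cons split: nat.splits)
qed

text \<open>Every strategy loses some play if its user faces balanced bars: the opponent always
  restores balance, so the user ends up with \<open>{p}\<close>. The parity of the last index says
  who receives it.\<close>

lemma balanced_strategy_plays:
  assumes "strategy p \<sigma>" "finite B" "if e then balanced p B else unbalanced p B"
  shows "\<exists>Bs. complete_play p B Bs \<and> follows e \<sigma> Bs \<and> even (length Bs - 1) = e"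
  using assms(2,3)
proof (induction B arbitrary: e rule: finite_psubset_induct)
  case (psubset B)
  show ?case
  proof (cases "B = {p}")
    case True
    then have e using psubset.prems not_balanced_if_unbalanced balanced_singleton by metis
    then show ?thesis
      by (intro exI[of _ "[{p}]"]) (simp add: True complete_play_def follows_def)
  next
    case False
    obtain B' where B': "B' \<in> moves p B" "e \<Longrightarrow> B' = \<sigma> B"
      "if \<not> e then balanced p B' else unbalanced p B'"
    proof (cases e)
      case True
      then have "\<sigma> B \<in> moves p B"
        using psubset.prems moves_nonempty_if_balanced False assms(1)
        by (auto simp: strategy_def)
      then show thesis using that[of "\<sigma> B"] unbalanced_after_move True psubset.prems by auto
    next
      case e: False
      then show thesis using that balancing_move[of p B] psubset.prems by auto
    qed
    obtain Bs where Bs: "complete_play p B' Bs" "follows (\<not> e) \<sigma> Bs"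
      "even (length Bs - 1) = (\<not> e)"
      using psubset.IH[OF moves_psubset[OF B'(1)] B'(3)] by blast
    moreover have "Bs \<noteq> []" using Bs(1) by (simp add: complete_play_def)
    ultimately show ?thesis
      using play_Cons[OF Bs(1,2) B'(1,2)]
      by (intro exI[of _ "B # Bs"]) (cases Bs, auto)
  qed
qed

lemma second_player_wins_iff_balanced:
  fixes a b c d :: nat and p :: cell
  defines "B \<equiv> rect p a b c d"
  shows "(\<exists>\<sigma>. second_player_wins_with p B \<sigma>) \<longleftrightarrow> a XOR b = c XOR d"
proof
  assume "\<exists>\<sigma>. second_player_wins_with p B \<sigma>"
  then obtain \<sigma> where \<sigma>: "strategy p \<sigma>"
    "\<And>Bs. complete_play p B Bs \<Longrightarrow> follows False \<sigma> Bs \<Longrightarrow> even (length Bs - 1)"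
    unfolding second_player_wins_with_def follows_def by auto
  show "a XOR b = c XOR d"
  proof (rule ccontr)
    assume "a XOR b \<noteq> c XOR d"
    then have "unbalanced p B" unfolding unbalanced_def B_def by blast
    then show False
      using balanced_strategy_plays[OF \<sigma>(1), of B False] \<sigma>(2) by (auto simp: B_def finite_rect)
  qed
next
  assume x: "a XOR b = c XOR d"
  \<comment> \<open>Restore balance if possible and otherwise play any legal move, since
    \<open>strategy\<close> demands an answer on every bar that has a move.\<close>
  define \<sigma> where "\<sigma> B = (SOME B'. B' \<in> moves p B \<and>
    (balanced p B' \<or> \<not> (\<exists>B'\<in>moves p B. balanced p B')))" for B
  have \<sigma>: "\<sigma> B \<in> moves p B \<and> (balanced p (\<sigma> B) \<or> \<not> (\<exists>B'\<in>moves p B. balanced p B'))"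
    if "moves p B \<noteq> {}" for B
    unfolding \<sigma>_def by (rule someI_ex) (use that in blast)
  have "even (length Bs - 1)"
    if Bs: "complete_play p B Bs" and f: "follows False \<sigma> Bs" for Bs
  proof -
    \<comment> \<open>The final bar \<open>{p}\<close> is balanced, so this invariant forces its
      index to be even.\<close>
    have "if even k then balanced p (Bs ! k) else unbalanced p (Bs ! k)" if "k < length Bs" for k
      using that
    proof (induction k)
      case 0
      then show ?case using Bs x by (auto simp: complete_play_def hd_conv_nth balanced_def B_def)
    next
      case (Suc k)
      then have m: "Bs ! Suc k \<in> moves p (Bs ! k)" using Bs by (simp add: complete_play_def)
      show ?case
      proof (cases "even k")
        case True
        then show ?thesis using Suc m unbalanced_after_move by auto
      next
        case False
        then have "Bs ! Suc k = \<sigma> (Bs ! k)" using f Suc.prems by (auto simp: follows_def)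
        moreover have "balanced p (\<sigma> (Bs ! k))"
          using \<sigma>[of "Bs ! k"] balancing_move[of p "Bs ! k"] Suc False by auto
        ultimately show ?thesis using False by simp
      qed
    qed
    from this[of "length Bs - 1"] show ?thesis
      using Bs not_balanced_if_unbalanced[of p "{p}"] balanced_singleton[of p]
      by (auto simp: complete_play_def last_conv_nth split: if_splits)
  qed
  moreover have "strategy p \<sigma>" using \<sigma> by (auto simp: strategy_def)
  ultimately show "\<exists>\<sigma>. second_player_wins_with p B \<sigma>"
    unfolding second_player_wins_with_def follows_def by (intro exI[of _ \<sigma>]) auto
qed

lemma P_positions_iff:
  "(i, j) \<in> P_positions m \<longleftrightarrow> (\<exists>a b c d :: nat. a + b + 1 = m \<and> c + d + 1 = m \<and>
     i = int a + 1 \<and> j = int c + 1 \<and> a XOR b = c XOR d)"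
proof -
  have *: "(i, j) \<in> P_positions m \<longleftrightarrow> a XOR b = c XOR d"
    if "a + b + 1 = m" "c + d + 1 = m" "i = int a + 1" "j = int c + 1" for a b c d
  proof -
    have "chocolate m = rect (i, j) a b c d"
      using that by (auto simp: chocolate_def rect_def)
    moreover have "(i, j) \<in> chocolate m"
      using that by (simp add: chocolate_def)
    ultimately show ?thesis
      using second_player_wins_iff_balanced[of "(i, j)" a b c d] by (simp add: P_positions_def)
  qed
  have "\<exists>a b c d. a + b + 1 = m \<and> c + d + 1 = m \<and> i = int a + 1 \<and> j = int c + 1"
    if "(i, j) \<in> P_positions m"
  proof -
    have "1 \<le> i" "i \<le> int m" "1 \<le> j" "j \<le> int m"
      using that by (auto simp: P_positions_def chocolate_def)
    then have "nat (i - 1) + nat (int m - i) + 1 = m" "nat (j - 1) + nat (int m - j) + 1 = m"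
      "i = int (nat (i - 1)) + 1" "j = int (nat (j - 1)) + 1" by auto
    then show ?thesis by (intro exI conjI)
  qed
  then show ?thesis using * by (intro iffI) (fast, elim exE conjE, simp)
qed

section \<open>The recursion for the P-positions\<close>

lemma xor_div_2: "(a XOR b) div 2 = (a div 2) XOR (b div 2)" for a b :: nat
  by (subst xor_nat_rec) simp

lemma xor_double:
  fixes a b :: nat
  shows "2 * a XOR 2 * b = 2 * (a XOR b)"
    and "Suc (2 * a) XOR 2 * b = Suc (2 * (a XOR b))"
    and "2 * a XOR Suc (2 * b) = Suc (2 * (a XOR b))"
    and "Suc (2 * a) XOR Suc (2 * b) = 2 * (a XOR b)"
  by (subst xor_nat_rec; simp)+

text \<open>Exactly one of \<open>a\<close>, \<open>b\<close> is odd; halving drops one unit there,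
  and which of the two it is decides the sign of the shift.\<close>

lemma div_2_of_odd_sum:
  fixes a b k :: nat
  assumes "a + b + 1 = 2 * k"
  shows "a div 2 + b div 2 + 1 = k"
    and "\<bar>int a - int b - 2 * (int (a div 2) - int (b div 2))\<bar> = 1"
proof -
  consider p q where "a = 2 * p" "b = 2 * q + 1" | p q where "a = 2 * p + 1" "b = 2 * q"
    using assms by (metis evenE oddE even_add even_mult_iff even_numeral odd_one)
  then have "a div 2 + b div 2 + 1 = k \<and>
    \<bar>int a - int b - 2 * (int (a div 2) - int (b div 2))\<bar> = 1"
    using assms by cases simp_all
  then show "a div 2 + b div 2 + 1 = k"
    "\<bar>int a - int b - 2 * (int (a div 2) - int (b div 2))\<bar> = 1" by blast+
qed

text \<open>The lowest bits agree, so they cancel in the difference; both are 0 or both are 1,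
  whence the two possible sums.\<close>

lemma div_2_of_even_sum:
  fixes a b k :: nat
  assumes "a + b = 2 * k"
  shows "a div 2 + b div 2 = k \<or> a div 2 + b div 2 + 1 = k"
    and "int a - int b = 2 * (int (a div 2) - int (b div 2))"
proof -
  consider p q where "a = 2 * p" "b = 2 * q" | p q where "a = 2 * p + 1" "b = 2 * q + 1"
    using assms by (metis evenE oddE even_add even_mult_iff even_numeral)
  then have "(a div 2 + b div 2 = k \<or> a div 2 + b div 2 + 1 = k) \<and>
    int a - int b = 2 * (int (a div 2) - int (b div 2))"
    using assms by cases auto
  then show "a div 2 + b div 2 = k \<or> a div 2 + b div 2 + 1 = k"
    "int a - int b = 2 * (int (a div 2) - int (b div 2))" by blast+
qed

text \<open>The cell \<open>(a + 1, c + 1)\<close> has, in coordinates with origin at the centre of the \<open>m \<times> m\<close> square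
  and unit half a cell, its centre at \<open>(a - b, c - d)\<close> where \<open>a + b = c + d = m - 1\<close>.\<close>

definition P_cell_centre :: "nat \<Rightarrow> int \<Rightarrow> int \<Rightarrow> bool" where
  "P_cell_centre m u v \<longleftrightarrow> (\<exists>a b c d :: nat. a + b + 1 = m \<and> c + d + 1 = m \<and>
     u = int a - int b \<and> v = int c - int d \<and> a XOR b = c XOR d)"

lemma P_cell_centreI:
  "a + b + 1 = m \<Longrightarrow> c + d + 1 = m \<Longrightarrow> u = int a - int b \<Longrightarrow> v = int c - int d \<Longrightarrow>
    a XOR b = c XOR d \<Longrightarrow> P_cell_centre m u v"
  unfolding P_cell_centre_def by blast

text \<open>The lowest bits differ within each pair, so both XORs have lowest bit 1 and the
  condition concerns only the halves. The free choice of the odd heap in each pair gives the four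
  signs.\<close>

lemma P_cell_centre_even:
  "P_cell_centre (2 * k) u v \<longleftrightarrow>
    (\<exists>u' v'. P_cell_centre k u' v' \<and> \<bar>u - 2 * u'\<bar> = 1 \<and> \<bar>v - 2 * v'\<bar> = 1)"
proof
  assume "P_cell_centre (2 * k) u v"
  then obtain a b c d :: nat where *: "a + b + 1 = 2 * k" "c + d + 1 = 2 * k"
    "u = int a - int b" "v = int c - int d" "a XOR b = c XOR d"
    by (auto simp: P_cell_centre_def)
  have "P_cell_centre k (int (a div 2) - int (b div 2)) (int (c div 2) - int (d div 2))"
  proof (rule P_cell_centreI)
    show "a div 2 XOR b div 2 = c div 2 XOR d div 2"
      unfolding xor_div_2[symmetric] *(5) ..
    show "a div 2 + b div 2 + 1 = k" "c div 2 + d div 2 + 1 = k"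
      using *(1,2) by (simp_all only: div_2_of_odd_sum)
  qed auto
  moreover have "\<bar>u - 2 * (int (a div 2) - int (b div 2))\<bar> = 1"
    "\<bar>v - 2 * (int (c div 2) - int (d div 2))\<bar> = 1"
    unfolding *(3,4) using *(1,2) by (simp_all only: div_2_of_odd_sum(2))
  ultimately show "\<exists>u' v'. P_cell_centre k u' v' \<and> \<bar>u - 2 * u'\<bar> = 1 \<and> \<bar>v - 2 * v'\<bar> = 1"
    by blast
next
  assume "\<exists>u' v'. P_cell_centre k u' v' \<and> \<bar>u - 2 * u'\<bar> = 1 \<and> \<bar>v - 2 * v'\<bar> = 1"
  then obtain a b c d :: nat where k: "a + b + 1 = k" "c + d + 1 = k"
    and x: "a XOR b = c XOR d"
    and uv: "\<bar>u - 2 * (int a - int b)\<bar> = 1" "\<bar>v - 2 * (int c - int d)\<bar> = 1"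
    by (auto simp: P_cell_centre_def)
  \<comment> \<open>The sign of the offset tells which of the doubled heaps receives the extra
    1.\<close>
  have split: "\<exists>a' b'. a' + b' + 1 = 2 * (a + b + 1) \<and> t = int a' - int b' \<and>
      a' XOR b' = 2 * (a XOR b) + 1" if "\<bar>t - 2 * (int a - int b)\<bar> = 1" for a b :: nat and t
  proof (cases "t = 2 * (int a - int b) + 1")
    case True
    then show ?thesis
      by (intro exI[of _ "2 * a + 1"] exI[of _ "2 * b"]) (simp add: xor_double)
  next
    case False
    with that have "t = 2 * (int a - int b) - 1" by linarith
    then show ?thesis
      by (intro exI[of _ "2 * a"] exI[of _ "2 * b + 1"]) (simp add: xor_double)
  qed
  from split[OF uv(1)] obtain a' b' where ab: "a' + b' + 1 = 2 * k" "u = int a' - int b'"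
    "a' XOR b' = 2 * (a XOR b) + 1" unfolding k by blast
  from split[OF uv(2)] obtain c' d' where cd: "c' + d' + 1 = 2 * k" "v = int c' - int d'"
    "c' XOR d' = 2 * (c XOR d) + 1" unfolding k by blast
  show "P_cell_centre (2 * k) u v"
    using P_cell_centreI[OF ab(1) cd(1) ab(2) cd(2)] ab(3) cd(3) x by simp
qed

lemma P_cell_centre_odd:
  "P_cell_centre (2 * k + 1) u v \<longleftrightarrow>
    (\<exists>u' v'. (P_cell_centre k u' v' \<or> P_cell_centre (k + 1) u' v') \<and> u = 2 * u' \<and> v = 2 * v')"
proof
  assume "P_cell_centre (2 * k + 1) u v"
  then obtain a b c d :: nat where *: "a + b = 2 * k" "c + d = 2 * k"
    "u = int a - int b" "v = int c - int d" "a XOR b = c XOR d"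
    by (auto simp: P_cell_centre_def)
  have x: "a div 2 XOR b div 2 = c div 2 XOR d div 2"
    unfolding xor_div_2[symmetric] *(5) ..
  \<comment> \<open>\<open>a XOR b\<close> and \<open>a + b\<close> have the same parity. Each half
    sum is \<open>k\<close> or one less, so equal parities make the half sums equal and exclude a
    mixture of sides \<open>k\<close> and \<open>k + 1\<close>.\<close>
  have "even (a div 2 + b div 2) = even (c div 2 + d div 2)"
    using arg_cong[OF x, of even] unfolding even_xor_iff even_add .
  moreover have "p + 1 = k \<and> q + 1 = k \<or> p + 1 = k + 1 \<and> q + 1 = k + 1"
    if "even p = even q" "p = k \<or> p + 1 = k" "q = k \<or> q + 1 = k" for p q
    using that by auto
  ultimately have "a div 2 + b div 2 + 1 = k \<and> c div 2 + d div 2 + 1 = k \<or>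
      a div 2 + b div 2 + 1 = k + 1 \<and> c div 2 + d div 2 + 1 = k + 1"
    using div_2_of_even_sum(1)[OF *(1)] div_2_of_even_sum(1)[OF *(2)] by blast
  then have "P_cell_centre k (int (a div 2) - int (b div 2)) (int (c div 2) - int (d div 2)) \<or>
    P_cell_centre (k + 1) (int (a div 2) - int (b div 2)) (int (c div 2) - int (d div 2))"
    using P_cell_centreI[OF _ _ refl refl x] by blast
  moreover have "u = 2 * (int (a div 2) - int (b div 2))" "v = 2 * (int (c div 2) - int (d div 2))"
    unfolding *(3,4) using div_2_of_even_sum(2)[OF *(1)] div_2_of_even_sum(2)[OF *(2)] by blast+
  ultimately show "\<exists>u' v'. (P_cell_centre k u' v' \<or> P_cell_centre (k + 1) u' v') \<and>
      u = 2 * u' \<and> v = 2 * v'" by blast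
next
  assume "\<exists>u' v'. (P_cell_centre k u' v' \<or> P_cell_centre (k + 1) u' v') \<and> u = 2 * u' \<and> v = 2 * v'"
  then obtain u' v' where P: "P_cell_centre k u' v' \<or> P_cell_centre (k + 1) u' v'"
    and uv: "u = 2 * u'" "v = 2 * v'" by blast
  from P show "P_cell_centre (2 * k + 1) u v"
  proof
    assume "P_cell_centre k u' v'"
    then obtain a b c d :: nat where "a + b + 1 = k" "c + d + 1 = k"
      "u' = int a - int b" "v' = int c - int d" "a XOR b = c XOR d"
      by (auto simp: P_cell_centre_def)
    then show ?thesis using uv
      by (intro P_cell_centreI[of "2 * a + 1" "2 * b + 1" _ "2 * c + 1" "2 * d + 1"])
        (simp_all add: xor_double)
  next
    assume "P_cell_centre (k + 1) u' v'"
    then obtain a b c d :: nat where "a + b = k" "c + d = k"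
      "u' = int a - int b" "v' = int c - int d" "a XOR b = c XOR d"
      by (auto simp: P_cell_centre_def)
    then show ?thesis using uv
      by (intro P_cell_centreI[of "2 * a" "2 * b" _ "2 * c" "2 * d"])
        (simp_all add: xor_double)
  qed
qed

section \<open>Horizontal sections of the octahedron\<close>

text \<open>Scaled by \<open>2\<^sup>n\<close> and with \<open>x, y\<close> replaced by \<open>x + y, x - y\<close>, the centres of the octahedra of
  level \<open>n\<close> are integer points, and octahedra are given by the two conditions
  \<open>\<bar>x + y\<bar> + \<bar>z\<bar> \<le> 1\<close> and \<open>\<bar>x - y\<bar> + \<bar>z\<bar> \<le> 1\<close> relative to the centre.\<close>

fun centre :: "nat \<Rightarrow> int \<Rightarrow> int \<Rightarrow> int \<Rightarrow> bool" where
  "centre 0 u v w \<longleftrightarrow> u = 0 \<and> v = 0 \<and> w = 0"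
| "centre (Suc n) u v w \<longleftrightarrow> (\<exists>u' v' w'. centre n u' v' w' \<and>
     (\<bar>u - 2 * u'\<bar> = 1 \<and> \<bar>v - 2 * v'\<bar> = 1 \<and> w = 2 * w' \<or>
      u = 2 * u' \<and> v = 2 * v' \<and> \<bar>w - 2 * w'\<bar> = 1))"

lemma centre_SucI:
  "centre n u' v' w' \<Longrightarrow> \<bar>u - 2 * u'\<bar> = 1 \<Longrightarrow> \<bar>v - 2 * v'\<bar> = 1 \<Longrightarrow> w = 2 * w' \<Longrightarrow> centre (Suc n) u v w"
  "centre n u' v' w' \<Longrightarrow> u = 2 * u' \<Longrightarrow> v = 2 * v' \<Longrightarrow> \<bar>w - 2 * w'\<bar> = 1 \<Longrightarrow> centre (Suc n) u v w"
  by auto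

text \<open>Both sides obey the same recursion. An even height comes only from horizontal children
  at half the height, an odd one only from vertical children of the two neighbouring heights. The
  case \<open>m = 0\<close> is included because \<open>m = 1\<close> leads to
  \<open>k = 0\<close>.\<close>

lemma centre_iff_P_cell_centre:
  "m \<le> 2 ^ n \<Longrightarrow> centre n u v (2 ^ n - int m) \<longleftrightarrow> P_cell_centre m u v"
proof (induction n arbitrary: m u v)
  case 0
  then have "m = 0 \<or> m = 1" by auto
  then show ?case by (auto simp: P_cell_centre_def)
next
  case (Suc n)
  show ?case
  proof (cases "even m")
    case True
    then obtain k where k: "m = 2 * k" by auto
    have le: "k \<le> 2 ^ n" using Suc.prems k by auto
    have w: "(2 ^ Suc n - int m = 2 * w') = (w' = 2 ^ n - int k)"
      "(\<bar>2 ^ Suc n - int m - 2 * w'\<bar> = 1) = False" for w'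
      using k by (auto, presburger)
    have "centre (Suc n) u v (2 ^ Suc n - int m) \<longleftrightarrow> (\<exists>u' v'. centre n u' v' (2 ^ n - int k) \<and>
        \<bar>u - 2 * u'\<bar> = 1 \<and> \<bar>v - 2 * v'\<bar> = 1)"
      unfolding centre.simps w by blast
    then show ?thesis
      unfolding Suc.IH[OF le] k P_cell_centre_even .
  next
    case False
    then obtain k where k: "m = 2 * k + 1" by (auto elim: oddE)
    have le: "k \<le> 2 ^ n" "k + 1 \<le> 2 ^ n" using Suc.prems k by auto
    have w: "(2 ^ Suc n - int m = 2 * w') = False"
      "(\<bar>2 ^ Suc n - int m - 2 * w'\<bar> = 1) = (w' = 2 ^ n - int k \<or> w' = 2 ^ n - int (k + 1))" for w'
      using k by (auto, presburger)
    have "centre (Suc n) u v (2 ^ Suc n - int m) \<longleftrightarrow> (\<exists>u' v'. (centre n u' v' (2 ^ n - int k) \<or>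
        centre n u' v' (2 ^ n - int (k + 1))) \<and> u = 2 * u' \<and> v = 2 * v')"
      unfolding centre.simps w by blast
    then show ?thesis
      unfolding Suc.IH[OF le(1)] Suc.IH[OF le(2)] k P_cell_centre_odd .
  qed
qed

section \<open>Equators and nested levels in integer coordinates\<close>

definition in_level :: "nat \<Rightarrow> real \<Rightarrow> real \<Rightarrow> real \<Rightarrow> bool" where
  "in_level n U V Z \<longleftrightarrow> (\<exists>u v w. centre n u v w \<and>
     \<bar>U - u\<bar> + \<bar>Z - w\<bar> \<le> 1 \<and> \<bar>V - v\<bar> + \<bar>Z - w\<bar> \<le> 1)"

definition on_equator :: "nat \<Rightarrow> real \<Rightarrow> real \<Rightarrow> int \<Rightarrow> bool" where
  "on_equator n U V w \<longleftrightarrow> (\<exists>u v. centre n u v w \<and> \<bar>U - u\<bar> \<le> 1 \<and> \<bar>V - v\<bar> \<le> 1)"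

lemma on_equator_imp_in_level: "on_equator n U V w \<Longrightarrow> in_level n U V w"
  unfolding on_equator_def in_level_def by fastforce

text \<open>The doubled square has half side 2 and is tiled by the equators of the four horizontal
  children, whose centres are offset by 1 in each coordinate.\<close>

lemma on_equator_Suc:
  assumes "on_equator n (U / 2) (V / 2) w"
  shows "on_equator (Suc n) U V (2 * w)"
proof -
  obtain u v where c: "centre n u v w" and UV: "\<bar>U / 2 - u\<bar> \<le> 1" "\<bar>V / 2 - v\<bar> \<le> 1"
    using assms by (auto simp: on_equator_def)
  have half: "\<exists>t'. \<bar>t' - 2 * t\<bar> = 1 \<and> \<bar>T - real_of_int t'\<bar> \<le> 1" if "\<bar>T / 2 - t\<bar> \<le> 1"
    for T :: real and t :: int
  proof (cases "T \<le> 2 * t")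
    case True
    with that show ?thesis by (intro exI[of _ "2 * t - 1"]) (auto simp: abs_le_iff field_simps)
  next
    case False
    with that show ?thesis by (intro exI[of _ "2 * t + 1"]) (auto simp: abs_le_iff field_simps)
  qed
  from half[OF UV(1)] half[OF UV(2)] c show ?thesis
    unfolding on_equator_def centre.simps by blast
qed

text \<open>Nestedness of the levels: each child octahedron lies in its parent.\<close>

lemma in_level_Suc:
  assumes "in_level (Suc n) U V Z"
  shows "in_level n (U / 2) (V / 2) (Z / 2)"
proof -
  obtain u v w where c: "centre (Suc n) u v w"
    and UVZ: "\<bar>U - u\<bar> + \<bar>Z - w\<bar> \<le> 1" "\<bar>V - v\<bar> + \<bar>Z - w\<bar> \<le> 1"
    using assms unfolding in_level_def by blast
  from c obtain u' v' w' where c': "centre n u' v' w'"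
    "\<bar>u - 2 * u'\<bar> = 1 \<and> \<bar>v - 2 * v'\<bar> = 1 \<and> w = 2 * w' \<or>
      u = 2 * u' \<and> v = 2 * v' \<and> \<bar>w - 2 * w'\<bar> = 1" by auto
  have abs: "\<bar>real_of_int s - 2 * real_of_int s'\<bar> = 1" if "\<bar>s - 2 * s'\<bar> = 1" for s s'
    using arg_cong[OF that, of real_of_int] by simp
  have half: "\<bar>S / 2 - s\<bar> + \<bar>T / 2 - t\<bar> = (\<bar>S - 2 * s\<bar> + \<bar>T - 2 * t\<bar>) / 2" for S T s t :: real
    by (simp add: abs_if field_simps)
  have "\<bar>U - 2 * u'\<bar> + \<bar>Z - 2 * w'\<bar> \<le> 2 \<and> \<bar>V - 2 * v'\<bar> + \<bar>Z - 2 * w'\<bar> \<le> 2"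
    using c'(2) UVZ abs[of u u'] abs[of v v'] abs[of w w'] by (elim disjE conjE) (simp, linarith)+
  with c'(1) show ?thesis
    unfolding in_level_def half by (intro exI[of _ u'] exI[of _ v'] exI[of _ w'] conjI) simp_all
qed

text \<open>An even height is handled one level up, where the equator is then subdivided. At an odd
  height the point lies on an equator or is a top or bottom vertex of an octahedron. The bound on
  \<open>w\<close> excludes the two poles, which lie on no equator.\<close>

lemma in_level_imp_on_equator:
  assumes "in_level n U V (real_of_int w)" "\<bar>w\<bar> < 2 ^ n"
  shows "on_equator n U V w"
  using assms
proof (induction n arbitrary: U V w)
  case 0
  then show ?case by (auto simp: in_level_def on_equator_def)
next
  case (Suc n)
  show ?case
  proof (cases "even w")
    case True
    then obtain w' where w: "w = 2 * w'" by auto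
    with Suc.prems in_level_Suc[OF Suc.prems(1)] show ?thesis
      unfolding w by (intro on_equator_Suc Suc.IH) auto
  next
    case False
    obtain u v t where c: "centre (Suc n) u v t"
      and UVZ: "\<bar>U - u\<bar> + \<bar>real_of_int w - t\<bar> \<le> 1" "\<bar>V - v\<bar> + \<bar>real_of_int w - t\<bar> \<le> 1"
      using Suc.prems unfolding in_level_def by blast
    show ?thesis
    proof (cases "t = w")
      case True
      with c UVZ show ?thesis unfolding on_equator_def by (intro exI[of _ u] exI[of _ v]) simp
    next
      case neq: False
      have "\<bar>real_of_int (w - t)\<bar> \<le> 1" using UVZ(1) by simp
      then have "\<bar>w - t\<bar> \<le> 1" by linarith
      then have t: "\<bar>w - t\<bar> = 1" using neq by linarith
      then have "\<bar>real_of_int w - real_of_int t\<bar> = 1" using arg_cong[OF t, of real_of_int] by simp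
      then have UV: "U = u" "V = v" using UVZ by auto
      have "even t" using t False by presburger
      then have "\<bar>t - 2 * w'\<bar> \<noteq> 1" for w' by presburger
      then obtain u' v' w' where c': "centre n u' v' w'"
        "\<bar>u - 2 * u'\<bar> = 1" "\<bar>v - 2 * v'\<bar> = 1" "t = 2 * w'" using c by auto
      \<comment> \<open>The octahedron at even height \<open>t\<close> is a horizontal child; the
        vertical child of the same parent at height \<open>w\<close> has the vertex as a corner of
        its equator.\<close>
      have "centre (Suc n) (2 * u') (2 * v') w"
        using c' t by (intro centre_SucI) auto
      moreover have "\<bar>U - of_int (2 * u')\<bar> \<le> 1" "\<bar>V - of_int (2 * v')\<bar> \<le> 1"
        using arg_cong[OF c'(2), of real_of_int] arg_cong[OF c'(3), of real_of_int] UV by auto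
      ultimately show ?thesis unfolding on_equator_def by blast
    qed
  qed
qed

text \<open>Level \<open>n\<close> decides: there the height becomes the integer \<open>w\<close>.
  Equators survive in all deeper levels, and nestedness covers the shallower ones.\<close>

lemma in_all_levels_iff:
  assumes "\<bar>w\<bar> < 2 ^ n"
  shows "(\<forall>N. in_level N (2 ^ N * X) (2 ^ N * Y) (2 ^ N * (real_of_int w / 2 ^ n))) \<longleftrightarrow>
    on_equator n (2 ^ n * X) (2 ^ n * Y) w"
proof
  assume "\<forall>N. in_level N (2 ^ N * X) (2 ^ N * Y) (2 ^ N * (real_of_int w / 2 ^ n))"
  from spec[OF this, of n] show "on_equator n (2 ^ n * X) (2 ^ n * Y) w"
    using assms by (intro in_level_imp_on_equator) auto
next
  assume *: "on_equator n (2 ^ n * X) (2 ^ n * Y) w"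
  let ?Z = "real_of_int w / 2 ^ n"
  have up: "on_equator (n + k) (2 ^ (n + k) * X) (2 ^ (n + k) * Y) (2 ^ k * w)" for k
  proof (induction k)
    case (Suc k)
    then show ?case
      using on_equator_Suc[of "n + k" "2 ^ Suc (n + k) * X" "2 ^ Suc (n + k) * Y" "2 ^ k * w"]
      by (simp add: mult.assoc)
  qed (use * in simp)
  have down: "in_level N (2 ^ N * X) (2 ^ N * Y) (2 ^ N * ?Z)"
    if "in_level (Suc N) (2 ^ Suc N * X) (2 ^ Suc N * Y) (2 ^ Suc N * ?Z)" for N
    using in_level_Suc[OF that] by simp
  show "\<forall>N. in_level N (2 ^ N * X) (2 ^ N * Y) (2 ^ N * ?Z)"
  proof
    fix N
    have "in_level (n + N) (2 ^ (n + N) * X) (2 ^ (n + N) * Y) (2 ^ (n + N) * ?Z)"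
      using on_equator_imp_in_level[OF up[of N]] by (simp add: power_add)
    then show "in_level N (2 ^ N * X) (2 ^ N * Y) (2 ^ N * ?Z)"
      by (rule inc_induct[OF le_add2]) (rule down)
  qed
qed

section \<open>Return to the real octahedra\<close>

lemma mem_level_octahedra_iff:
  "(c, a) \<in> level_octahedra n \<longleftrightarrow> a = 1 / 2 ^ n \<and> (\<exists>u v w. centre n u v w \<and>
     c = ((real_of_int u + v) / (2 * 2 ^ n), (real_of_int u - v) / (2 * 2 ^ n), real_of_int w / 2 ^ n))"
proof (induction n arbitrary: c a)
  case 0
  show ?case by (auto simp: zero_prod_def)
next
  case (Suc n)
  let ?c = "\<lambda>n u v w. ((real_of_int u + real_of_int v) / (2 * 2 ^ n),
    (real_of_int u - real_of_int v) / (2 * 2 ^ n), real_of_int w / 2 ^ n)"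
  \<comment> \<open>The half radius is one unit of level \<open>n + 1\<close>. The factor 2 on the
    horizontal entries of \<open>d\<close> arises because \<open>u + v\<close> and
    \<open>u - v\<close> are twice the scaled \<open>x\<close> and \<open>y\<close>.\<close>
  have step: "?c n u' v' w' + (1 / 2 ^ n / 2) *\<^sub>R d = ?c (Suc n) u v w \<longleftrightarrow>
      real_of_int u + v = 2 * (real_of_int u' + v') + 2 * fst d \<and>
      real_of_int u - v = 2 * (real_of_int u' - v') + 2 * fst (snd d) \<and>
      real_of_int w = 2 * real_of_int w' + snd (snd d)" for u v w u' v' w' d
  proof -
    have "p / (2 * s) + 1 / s / 2 * e = q / (2 * (2 * s)) \<longleftrightarrow> q = 2 * p + 2 * e"
      "p / s + 1 / s / 2 * e = q / (2 * s) \<longleftrightarrow> q = 2 * p + e" if "s > 0" for p q e s :: real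
    proof -
      have "p / (2 * s) + 1 / s / 2 * e = (2 * p + 2 * e) / (2 * (2 * s))"
        "p / s + 1 / s / 2 * e = (2 * p + e) / (2 * s)"
        using that by (simp_all add: field_simps)
      then show "p / (2 * s) + 1 / s / 2 * e = q / (2 * (2 * s)) \<longleftrightarrow> q = 2 * p + 2 * e"
        "p / s + 1 / s / 2 * e = q / (2 * s) \<longleftrightarrow> q = 2 * p + e"
        using that by auto
    qed
    then show ?thesis by (cases d) simp
  qed
  show ?case (is "?L \<longleftrightarrow> ?R")
  proof
    assume ?L
    then obtain c' a' d where "(c', a') \<in> level_octahedra n" and d: "d \<in> axis_dirs"
      and c: "c = c' + (a' / 2) *\<^sub>R d" "a = a' / 2" by auto
    then obtain u' v' w' where a': "a' = 1 / 2 ^ n" and c': "centre n u' v' w'" "c' = ?c n u' v' w'"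
      unfolding Suc.IH by blast
    obtain u v w where cen: "centre (Suc n) u v w" and
      "real_of_int u + v = 2 * (real_of_int u' + v') + 2 * fst d"
      "real_of_int u - v = 2 * (real_of_int u' - v') + 2 * fst (snd d)"
      "real_of_int w = 2 * real_of_int w' + snd (snd d)"
    proof -
      \<comment> \<open>In rotated coordinates a horizontal unit vector changes both
        \<open>u\<close> and \<open>v\<close> by one, a vertical one only \<open>w\<close>.\<close>
      from d consider "d = (1,0,0)" | "d = (-1,0,0)" | "d = (0,1,0)" | "d = (0,-1,0)"
        | "d = (0,0,1)" | "d = (0,0,-1)" by (auto simp: axis_dirs_def)
      then show thesis
      proof cases
        case 1 then show thesis
          by (intro that[OF centre_SucI(1)[OF c'(1), where u="2 * u' + 1" and v="2 * v' + 1" and w="2 * w'"]]) simp_all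
      next
        case 2 then show thesis
          by (intro that[OF centre_SucI(1)[OF c'(1), where u="2 * u' - 1" and v="2 * v' - 1" and w="2 * w'"]]) simp_all
      next
        case 3 then show thesis
          by (intro that[OF centre_SucI(1)[OF c'(1), where u="2 * u' + 1" and v="2 * v' - 1" and w="2 * w'"]]) simp_all
      next
        case 4 then show thesis
          by (intro that[OF centre_SucI(1)[OF c'(1), where u="2 * u' - 1" and v="2 * v' + 1" and w="2 * w'"]]) simp_all
      next
        case 5 then show thesis
          by (intro that[OF centre_SucI(2)[OF c'(1), where u="2 * u'" and v="2 * v'" and w="2 * w' + 1"]]) simp_all
      next
        case 6 then show thesis
          by (intro that[OF centre_SucI(2)[OF c'(1), where u="2 * u'" and v="2 * v'" and w="2 * w' - 1"]]) simp_all
      qed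
    qed
    then have "c = ?c (Suc n) u v w"
      unfolding c a' c'(2) by (subst step) simp
    with cen have "\<exists>u v w. centre (Suc n) u v w \<and> c = ?c (Suc n) u v w" by blast
    moreover have "a = 1 / 2 ^ Suc n" by (simp add: c a')
    ultimately show ?R by (rule conjI[rotated])
  next
    assume ?R
    then obtain u v w where a: "a = 1 / 2 ^ Suc n" and "centre (Suc n) u v w"
      and c: "c = ?c (Suc n) u v w" by blast
    have odd: "\<bar>s - 2 * s'\<bar> = 1 \<Longrightarrow> s = 2 * s' + 1 \<or> s = 2 * s' - 1" for s s' :: int
      by arith
    from \<open>centre (Suc n) u v w\<close> obtain u' v' w' where c': "centre n u' v' w'"
      and "\<bar>u - 2 * u'\<bar> = 1 \<and> \<bar>v - 2 * v'\<bar> = 1 \<and> w = 2 * w' \<or>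
        u = 2 * u' \<and> v = 2 * v' \<and> \<bar>w - 2 * w'\<bar> = 1" by auto
    then consider "u = 2 * u' + 1" "v = 2 * v' + 1" "w = 2 * w'"
      | "u = 2 * u' - 1" "v = 2 * v' - 1" "w = 2 * w'"
      | "u = 2 * u' + 1" "v = 2 * v' - 1" "w = 2 * w'"
      | "u = 2 * u' - 1" "v = 2 * v' + 1" "w = 2 * w'"
      | "u = 2 * u'" "v = 2 * v'" "w = 2 * w' + 1"
      | "u = 2 * u'" "v = 2 * v'" "w = 2 * w' - 1"
      using odd[of u u'] odd[of v v'] odd[of w w'] by satx
    then obtain d where d: "d \<in> axis_dirs"
      "real_of_int u + v = 2 * (real_of_int u' + v') + 2 * fst d"
      "real_of_int u - v = 2 * (real_of_int u' - v') + 2 * fst (snd d)"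
      "real_of_int w = 2 * real_of_int w' + snd (snd d)"
    proof cases
      case 1 then show thesis by (intro that[of "(1,0,0)"]) (simp_all add: axis_dirs_def)
    next
      case 2 then show thesis by (intro that[of "(-1,0,0)"]) (simp_all add: axis_dirs_def)
    next
      case 3 then show thesis by (intro that[of "(0,1,0)"]) (simp_all add: axis_dirs_def)
    next
      case 4 then show thesis by (intro that[of "(0,-1,0)"]) (simp_all add: axis_dirs_def)
    next
      case 5 then show thesis by (intro that[of "(0,0,1)"]) (simp_all add: axis_dirs_def)
    next
      case 6 then show thesis by (intro that[of "(0,0,-1)"]) (simp_all add: axis_dirs_def)
    qed
    have "?c n u' v' w' + (1 / 2 ^ n / 2) *\<^sub>R d = c"
      unfolding c step using d by blast
    moreover have "(?c n u' v' w', 1 / 2 ^ n) \<in> level_octahedra n"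
      using c' unfolding Suc.IH by blast
    ultimately show ?L unfolding a level_octahedra.simps
      by (intro UN_I[of "(?c n u' v' w', 1 / 2 ^ n)"]) (use d(1) in \<open>auto simp: image_iff\<close>)
  qed
qed

lemma sierpinski_level_eq: "sierpinski_level n = (\<Union>(c, a)\<in>level_octahedra n. octahedron c a)"
proof (cases n)
  case (Suc k)
  have *: "octahedron_T (fst q) (snd q) =
      (\<Union>d\<in>axis_dirs. octahedron (fst q + (snd q / 2) *\<^sub>R d) (snd q / 2))"
    if "q \<in> level_octahedra k" for q
    using that mem_level_octahedra_iff[of "fst q" "snd q" k] by (intro octahedron_T_eq) simp
  have "sierpinski_level n = (\<Union>(c, a)\<in>level_octahedra k. \<Union>d\<in>axis_dirs.
      octahedron (c + (a/2) *\<^sub>R d) (a/2))"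
    unfolding Suc sierpinski_level.simps case_prod_unfold by (rule SUP_cong[OF refl *])
  also have "\<dots> = (\<Union>(c, a)\<in>level_octahedra n. octahedron c a)"
    unfolding Suc by (simp add: UN_UN_flatten case_prod_unfold)
  finally show ?thesis .
qed simp

lemma mem_sierpinski_level_iff:
  "(x, y, z) \<in> sierpinski_level n \<longleftrightarrow> in_level n (2 ^ n * (x + y)) (2 ^ n * (x - y)) (2 ^ n * z)"
proof -
  let ?c = "\<lambda>u v w. ((real_of_int u + v) / (2 * 2 ^ n), (real_of_int u - v) / (2 * 2 ^ n),
    real_of_int w / 2 ^ n)"
  have *: "(x, y, z) \<in> octahedron (?c u v w) (1 / 2 ^ n) \<longleftrightarrow>
    \<bar>2 ^ n * (x + y) - u\<bar> + \<bar>2 ^ n * z - w\<bar> \<le> 1 \<and> \<bar>2 ^ n * (x - y) - v\<bar> + \<bar>2 ^ n * z - w\<bar> \<le> 1"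
    for u v w :: int
  proof -
    define s :: real where "s = 2 ^ n"
    define p q r where "p = x - (real_of_int u + v) / (2 * s)"
      and "q = y - (real_of_int u - v) / (2 * s)" and "r = z - w / s"
    have s: "s > 0" by (simp add: s_def)
    have scale: "\<bar>s * t\<bar> = s * \<bar>t\<bar>" for t using s by (simp add: abs_mult)
    have eqs: "s * (p + q) = s * (x + y) - u" "s * (p - q) = s * (x - y) - v" "s * r = s * z - w"
      using s by (simp_all add: p_def q_def r_def field_simps)
    have "\<bar>s * (p + q)\<bar> + \<bar>s * r\<bar> \<le> 1 \<and> \<bar>s * (p - q)\<bar> + \<bar>s * r\<bar> \<le> 1 \<longleftrightarrow>
        \<bar>p + q\<bar> + \<bar>r\<bar> \<le> 1 / s \<and> \<bar>p - q\<bar> + \<bar>r\<bar> \<le> 1 / s"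
      unfolding scale using s by (simp add: field_simps)
    \<comment> \<open>\<open>\<bar>p\<bar> + \<bar>q\<bar>\<close> is the maximum of
      \<open>\<bar>p + q\<bar>\<close> and \<open>\<bar>p - q\<bar>\<close>.\<close>
    also have "\<dots> \<longleftrightarrow> \<bar>p\<bar> + \<bar>q\<bar> + \<bar>r\<bar> \<le> 1 / s"
      by linarith
    finally show ?thesis
      unfolding eqs by (simp add: octahedron_iff s_def p_def q_def r_def)
  qed
  have "(x, y, z) \<in> sierpinski_level n \<longleftrightarrow>
      (\<exists>c a. (c, a) \<in> level_octahedra n \<and> (x, y, z) \<in> octahedron c a)"
    unfolding sierpinski_level_eq by blast
  also have "\<dots> \<longleftrightarrow> (\<exists>u v w. centre n u v w \<and> (x, y, z) \<in> octahedron (?c u v w) (1 / 2 ^ n))"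
    unfolding mem_level_octahedra_iff by blast
  finally show ?thesis unfolding * in_level_def .
qed

lemma mem_section_H_iff:
  assumes "1 \<le> m"
  shows "(x, y) \<in> section_H (real m / 2 ^ m) \<longleftrightarrow>
    (\<exists>u v. P_cell_centre m u v \<and> \<bar>2 ^ m * (x + y) - u\<bar> \<le> 1 \<and> \<bar>2 ^ m * (x - y) - v\<bar> \<le> 1)"
proof -
  \<comment> \<open>At level \<open>m\<close> the plane has integer height \<open>2 ^ m - m\<close>,
    which is positive by this bound and below the pole because \<open>m\<close> is positive.\<close>
  have m: "m < 2 ^ m" by simp
  then have m': "int m < 2 ^ m" by (metis of_nat_less_iff of_nat_numeral of_nat_power)
  have z: "1 - real m / 2 ^ m = real_of_int (2 ^ m - int m) / 2 ^ m"
    by (simp add: field_simps)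
  have "(x, y) \<in> section_H (real m / 2 ^ m) \<longleftrightarrow>
      on_equator m (2 ^ m * (x + y)) (2 ^ m * (x - y)) (2 ^ m - int m)"
    unfolding section_H_def sierpinski_octahedron_def z
    using in_all_levels_iff[of "2 ^ m - int m" m "x + y" "x - y"] m' assms
    by (simp add: mem_sierpinski_level_iff)
  then show ?thesis
    using m by (simp add: on_equator_def centre_iff_P_cell_centre)
qed

section \<open>The similarity\<close>

text \<open>A P-cell given by \<open>a\<close>, \<open>b\<close> spans \<open>a\<close> to
  \<open>a + 1\<close> in the first coordinate; doubling its midpoint and subtracting
  \<open>m = a + b + 1\<close> gives \<open>a - b\<close>.\<close>

lemma mem_pattern_iff:
  "(X, Y) \<in> pattern m \<longleftrightarrow>
    (\<exists>u v. P_cell_centre m u v \<and> \<bar>2 * X - real m - u\<bar> \<le> 1 \<and> \<bar>2 * Y - real m - v\<bar> \<le> 1)"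
proof
  assume "(X, Y) \<in> pattern m"
  then obtain i j x y where xy: "X = real_of_int i - x" "Y = real_of_int j - y"
    "0 \<le> x" "x \<le> 1" "0 \<le> y" "y \<le> 1" and P: "(i, j) \<in> P_positions m"
    unfolding pattern_def by blast
  from P obtain a b c d :: nat where *: "a + b + 1 = m" "c + d + 1 = m"
    "i = int a + 1" "j = int c + 1" "a XOR b = c XOR d"
    unfolding P_positions_iff by blast
  have "P_cell_centre m (int a - int b) (int c - int d)"
    using P_cell_centreI[OF *(1,2) refl refl *(5)] .
  moreover have "real m = real a + real b + 1" "real m = real c + real d + 1"
    using *(1,2) by linarith+
  then have "\<bar>2 * X - real m - real_of_int (int a - int b)\<bar> \<le> 1"
    "\<bar>2 * Y - real m - real_of_int (int c - int d)\<bar> \<le> 1"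
    using *(3,4) xy by (simp_all add: abs_le_iff)
  ultimately show "\<exists>u v. P_cell_centre m u v \<and> \<bar>2 * X - real m - u\<bar> \<le> 1 \<and> \<bar>2 * Y - real m - v\<bar> \<le> 1"
    by blast
next
  assume "\<exists>u v. P_cell_centre m u v \<and> \<bar>2 * X - real m - u\<bar> \<le> 1 \<and> \<bar>2 * Y - real m - v\<bar> \<le> 1"
  then obtain u v where P: "P_cell_centre m u v"
    and XY: "\<bar>2 * X - real m - u\<bar> \<le> 1" "\<bar>2 * Y - real m - v\<bar> \<le> 1" by blast
  from P obtain a b c d :: nat where *: "a + b + 1 = m" "c + d + 1 = m"
    "u = int a - int b" "v = int c - int d" "a XOR b = c XOR d"
    unfolding P_cell_centre_def by blast
  have P': "(int a + 1, int c + 1) \<in> P_positions m"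
    unfolding P_positions_iff using * by blast
  have m: "real m = real a + real b + 1" "real m = real c + real d + 1"
    using *(1,2) by linarith+
  have "\<exists>x. X = real_of_int (int a + 1) - x \<and> 0 \<le> x \<and> x \<le> 1"
    using XY(1) m(1) *(3) by (intro exI[of _ "real a + 1 - X"]) (simp add: abs_le_iff)
  moreover have "\<exists>y. Y = real_of_int (int c + 1) - y \<and> 0 \<le> y \<and> y \<le> 1"
    using XY(2) m(2) *(4) by (intro exI[of _ "real c + 1 - Y"]) (simp add: abs_le_iff)
  ultimately show "(X, Y) \<in> pattern m"
    using P' unfolding pattern_def by blast
qed

theorem theorem7:
  fixes m :: nat
  assumes "m \<ge> 1"
  shows "similar (pattern m) (section_H (real m / 2 ^ m))"
proof -
  define s :: real where "s = 2 ^ m"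
  have s: "s > 0" by (simp add: s_def)
  \<comment> \<open>Solved from \<open>s * (x + y) = 2 * X - m\<close> and
    \<open>s * (x - y) = 2 * Y - m\<close>, which match the two membership criteria. Its linear part
    is an orthogonal map times \<open>sqrt 2 / s\<close>, and \<open>g\<close> is the
    inverse.\<close>
  define f :: "real \<times> real \<Rightarrow> real \<times> real" where
    "f = (\<lambda>(X, Y). ((X + Y - real m) / s, (X - Y) / s))"
  define g :: "real \<times> real \<Rightarrow> real \<times> real" where
    "g = (\<lambda>(x, y). ((s * (x + y) + real m) / 2, (s * (x - y) + real m) / 2))"
  have fg: "f (g p) = p" for p
    using s by (cases p) (simp add: f_def g_def field_simps)
  have mem: "f p \<in> section_H (real m / 2 ^ m) \<longleftrightarrow> p \<in> pattern m" for p
  proof -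
    obtain X Y where p: "p = (X, Y)" by (cases p)
    have "s * ((X + Y - real m) / s + (X - Y) / s) = 2 * X - real m"
      "s * ((X + Y - real m) / s - (X - Y) / s) = 2 * Y - real m"
      using s by (simp_all add: field_simps)
    then show ?thesis
      unfolding p f_def prod.case mem_section_H_iff[OF assms] mem_pattern_iff s_def by simp
  qed
  show ?thesis
    unfolding similar_def
  proof (intro exI conjI allI)
    show "sqrt 2 / s > 0" using s by simp
    show "surj f" using fg by (metis surjI)
    show "f ` pattern m = section_H (real m / 2 ^ m)"
    proof (intro equalityI subsetI)
      fix p assume "p \<in> section_H (real m / 2 ^ m)"
      then have "g p \<in> pattern m" using mem[of "g p"] fg[of p] by simp
      with fg[of p] show "p \<in> f ` pattern m" by (intro image_eqI[of _ _ "g p"]) simp_all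
    qed (use mem in blast)
    show "dist (f u) (f v) = sqrt 2 / s * dist u v" for u v
    proof -
      obtain X Y X' Y' where uv: "u = (X, Y)" "v = (X', Y')" by (cases u, cases v)
      have "((X + Y - real m) / s - (X' + Y' - real m) / s)\<^sup>2 + ((X - Y) / s - (X' - Y') / s)\<^sup>2 =
          2 / s\<^sup>2 * ((X - X')\<^sup>2 + (Y - Y')\<^sup>2)"
        using s by (simp add: field_simps power2_eq_square)
      then show ?thesis
        using s by (simp add: uv f_def dist_Pair_Pair dist_real_def real_sqrt_mult real_sqrt_divide
            del: distrib_left_numeral)
    qed
  qed
qed

end
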